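(* If $p=\langle H,f,f^-,c\rangle$ is a loopless $p$-dialectical system with connectives, then $A_p$ is a completion.
   Context: An enumeration operator is a c.e. set $H$ of (codes of) pairs $\langle x,D\rangle$, $x\in\omega$, $D\subseteq\omega$ finite; $H(X)=\{x:\exists D\subseteq X\ \langle x,D\rangle\in H\}$. $H$ is an algebraic closure operator if $X\subseteq H(X)$ and $H(H(X))\subseteq H(X)$ for all $X$. A computable approximation $\alpha=\{H_s\}$ to $H$ is a computable increasing sequence of finite sets of pairs with union $H$. A $p$-dialectical system is $p=\langle H,f,f^-,c\rangle$ with $H$ an enumeration operator that is an algebraic closure operator, $H(\emptyset)\ne\emptyset$, $H(\{c\})=\omega$; $f$ a computable permutation of $\omega$ ($f_i=f(i)$); $f^-$ computable and acyclic (every $f^-$-orbit infinite); $c\in\omega$. $p$-dialectical procedure relative to $\alpha$: stacks $r_s(x)$, $m(s)$, finite sets $A_s$; $\rho_s(x)$ = top of $r_s(x)$ when nonempty, $L_s(x)=\{\rho_s(y):y<x,\ r_s(y)\ne\langle\,\rangle\}$, $\chi_s(i)=H_s(L_s(i+1))$. Stage 0: $m(0)=0$, $r_0(0)=\langle f_0\rangle$, others empty, $A_0=\emptyset$. Stage $s+1$, $m=m(s)$: (1) if no $k\le m$ has $c\in\chi_s(k)$: $m(s+1)=m+1$, stacks at $x\le m$ unchanged, $r_{s+1}(m+1)=\langle f_{m+1}\rangle$, above empty; (2) otherwise with $z$ least such $k$: $m(s+1)=z$, stacks at $x<z$ unchanged, $r_{s+1}(z)=r_s(z)^\frown\langle f^-(\rho_s(z))\rangle$,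 stacks at $x>z$ empty. $A_{s+1}=\bigcup_{i<m(s+1)}\chi_{s+1}(i)$. $A_p=\{f_x:\exists t\,\forall s\ge t\ f_x\in A_s\}$ (independent of $\alpha$). $p$ is loopless if for some $\alpha$, for every $u$ the set $\{\rho_s(u):s\in\omega\}$ is finite. The system has connectives if there are injective computable functions $\neg,\to,\wedge,\vee$ on $\omega$ such that for all $X\subseteq\omega$, $x,y\in\omega$: (1) $c\in H(\{x,\neg x\})$; (2) $H(\{\neg\neg x\})=H(\{x\})$; (3) $x\vee\neg x\in H(\emptyset)$; (4) $H(X\cup\{x\vee y\})=H(X\cup\{x\})\cap H(X\cup\{y\})$; (5) if $c\in H(X\cup\{x\})$ then $\neg x\in H(X)$; (6) $x\in H(X\cup\{y\})$ iff $y\to x\in H(X)$. A set $A$ is a completion if for every $x$, $A\cap\{x,\neg x\}$ has exactly one element. *)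

theory Defs
  imports Main "HOL-Library.Nat_Bijection"
begin

section \<open>Computability\<close>

text \<open>
  Kleene's partial recursive functions. Programs carry no arity: a program applied to an argument
  list of unsuitable length is either undefined or ignores the superfluous arguments, so restricted
  to argument lists of a fixed length every program still denotes a partial recursive function.
  In \<open>PrimRec\<close> and \<open>Mu\<close> the recursion (respectively search) variable comes first.
\<close>

datatype recf =
    Zero
  | Succ
  | Proj nat
  | Comp recf "recf list"
  | PrimRec recf recf
  | Mu recf

inductive rec_eval :: "recf \<Rightarrow> nat list \<Rightarrow> nat \<Rightarrow> bool" where
  zero: "rec_eval Zero xs 0"
| succ: "rec_eval Succ (x # xs) (Suc x)"
| proj: "i < length xs \<Longrightarrow> rec_eval (Proj i) xs (xs ! i)"
| comp: "list_all2 (\<lambda>h y. rec_eval h xs y) hs ys \<Longrightarrow> rec_eval g ys z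
    \<Longrightarrow> rec_eval (Comp g hs) xs z"
| prim_0: "rec_eval g xs y \<Longrightarrow> rec_eval (PrimRec g h) (0 # xs) y"
| prim_Suc: "rec_eval (PrimRec g h) (n # xs) y \<Longrightarrow> rec_eval h (n # y # xs) z
    \<Longrightarrow> rec_eval (PrimRec g h) (Suc n # xs) z"
| mu: "rec_eval g (n # xs) 0 \<Longrightarrow> (\<forall>i<n. \<exists>y. rec_eval g (i # xs) (Suc y))
    \<Longrightarrow> rec_eval (Mu g) xs n"

inductive_cases rec_eval_ZeroE: "rec_eval Zero xs y"
inductive_cases rec_eval_SuccE: "rec_eval Succ xs y"
inductive_cases rec_eval_ProjE: "rec_eval (Proj i) xs y"
inductive_cases rec_eval_CompE: "rec_eval (Comp g hs) xs y"
inductive_cases rec_eval_PrimRec_0E: "rec_eval (PrimRec g h) (0 # xs) y"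
inductive_cases rec_eval_PrimRec_SucE: "rec_eval (PrimRec g h) (Suc n # xs) y"
inductive_cases rec_eval_MuE: "rec_eval (Mu g) xs y"

lemma rec_eval_deterministic: "rec_eval e xs y \<Longrightarrow> rec_eval e xs z \<Longrightarrow> y = z"
proof (induction arbitrary: z rule: rec_eval.induct)
  case (zero xs)
  then show ?case by (elim rec_eval_ZeroE) simp
next
  case (succ x xs)
  then show ?case by (elim rec_eval_SuccE) simp
next
  case (proj i xs)
  from proj.prems show ?case by (rule rec_eval_ProjE) simp
next
  case (comp xs hs ys g w)
  from comp.prems obtain ys' where
    ys': "list_all2 (\<lambda>h y. rec_eval h xs y) hs ys'" "rec_eval g ys' z"
    by (rule rec_eval_CompE)
  have "ys = ys'"
  proof (rule nth_equalityI)
    show "length ys = length ys'"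
      by (rule trans[OF list_all2_lengthD[OF comp.IH(1), symmetric] list_all2_lengthD[OF ys'(1)]])
    fix i assume "i < length ys"
    then have "i < length hs"
      by (simp only: list_all2_lengthD[OF comp.IH(1)])
    then show "ys ! i = ys' ! i"
      using list_all2_nthD[OF comp.IH(1)] list_all2_nthD[OF ys'(1)] by blast
  qed
  with comp.IH(2) ys'(2) show ?case by blast
next
  case (prim_0 g xs y h)
  from prim_0.prems have "rec_eval g xs z" by (rule rec_eval_PrimRec_0E)
  then show ?case by (rule prim_0.IH)
next
  case (prim_Suc g h n xs y w)
  from prim_Suc.prems obtain y' where
    "rec_eval (PrimRec g h) (n # xs) y'" "rec_eval h (n # y' # xs) z"
    by (rule rec_eval_PrimRec_SucE)
  with prim_Suc.IH show ?case by blast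
next
  case (mu g n xs)
  from mu.prems have z:
    "rec_eval g (z # xs) 0 \<and> (\<forall>i<z. \<exists>y. rec_eval g (i # xs) (Suc y))"
    by (rule rec_eval_MuE) (rule conjI)
  have "\<not> n < z"
  proof
    assume "n < z"
    with z obtain y where "rec_eval g (n # xs) (Suc y)" by blast
    from mu.IH(1)[OF this] show False by simp
  qed
  moreover have "\<not> z < n"
  proof
    assume "z < n"
    with mu.IH(2) obtain y where "\<And>v. rec_eval g (z # xs) v \<Longrightarrow> Suc y = v" by blast
    from this[OF conjunct1[OF z]] show False by simp
  qed
  ultimately show ?case by simp
qed

definition computable :: "(nat \<Rightarrow> nat) \<Rightarrow> bool" where
  "computable g \<longleftrightarrow> (\<exists>e. \<forall>x. rec_eval e [x] (g x))"

definition computable2 :: "(nat \<Rightarrow> nat \<Rightarrow> nat) \<Rightarrow> bool" where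
  "computable2 g \<longleftrightarrow> (\<exists>e. \<forall>x y. rec_eval e [x, y] (g x y))"

text \<open>C.e. sets are the domains of the unary partial recursive functions.\<close>

definition ce :: "nat set \<Rightarrow> bool" where
  "ce S \<longleftrightarrow> (\<exists>e. S = {x. \<exists>y. rec_eval e [x] y})"

section \<open>Enumeration operators\<close>

text \<open>
  An enumeration operator is given by a set of codes of pairs \<open>(x, D)\<close>; the finite set \<open>D\<close> is
  coded by its canonical index \<open>set_encode D\<close>, the sum of \<open>2 ^ d\<close> over \<open>d \<in> D\<close>. As
  \<open>set_encode\<close> is meaningful on finite sets only, finiteness of \<open>D\<close> is required explicitly.
\<close>

definition enum_app :: "nat set \<Rightarrow> nat set \<Rightarrow> nat set" where
  "enum_app H X = {x. \<exists>D. finite D \<and> D \<subseteq> X \<and> prod_encode (x, set_encode D) \<in> H}"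

definition enumeration_operator :: "nat set \<Rightarrow> bool" where
  "enumeration_operator H \<longleftrightarrow> ce H"

definition algebraic_closure_operator :: "nat set \<Rightarrow> bool" where
  "algebraic_closure_operator H \<longleftrightarrow>
     (\<forall>X. X \<subseteq> enum_app H X \<and> enum_app H (enum_app H X) \<subseteq> enum_app H X)"

text \<open>Computability of a sequence of finite sets refers to their canonical indices.\<close>

definition computable_approximation :: "(nat \<Rightarrow> nat set) \<Rightarrow> nat set \<Rightarrow> bool" where
  "computable_approximation \<alpha> H \<longleftrightarrow>
     (\<forall>s. finite (\<alpha> s)) \<and> computable (\<lambda>s. set_encode (\<alpha> s)) \<and>
     (\<forall>s. \<alpha> s \<subseteq> \<alpha> (Suc s)) \<and> (\<Union>s. \<alpha> s) = H"

section \<open>\<open>p\<close>-dialectical systems\<close>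

text \<open>The fields of a system are, in this order, \<open>H\<close>, \<open>f\<close>, \<open>f\<^sup>-\<close> and \<open>c\<close>.\<close>

record p_system =
  oper :: "nat set"
  perm :: "nat \<Rightarrow> nat"
  repl :: "nat \<Rightarrow> nat"
  contra :: nat

definition acyclic_fun :: "(nat \<Rightarrow> nat) \<Rightarrow> bool" where
  "acyclic_fun g \<longleftrightarrow> (\<forall>x. infinite (range (\<lambda>n. (g ^^ n) x)))"

definition p_dialectical_system :: "p_system \<Rightarrow> bool" where
  "p_dialectical_system p \<longleftrightarrow>
     enumeration_operator (oper p) \<and> algebraic_closure_operator (oper p) \<and>
     enum_app (oper p) {} \<noteq> {} \<and> enum_app (oper p) {contra p} = UNIV \<and>
     computable (perm p) \<and> bij (perm p) \<and>
     computable (repl p) \<and> acyclic_fun (repl p)"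

text \<open>
  The state after a stage consists of \<open>m(s)\<close> and the stacks \<open>r\<^sub>s\<close>; the top of a stack is the last
  element of the list. In \<open>L\<close> and \<open>\<chi>\<close> the argument \<open>r\<close> is \<open>r\<^sub>s\<close>, and \<open>h\<close> is \<open>H\<^sub>s\<close>.
\<close>

definition L :: "(nat \<Rightarrow> nat list) \<Rightarrow> nat \<Rightarrow> nat set" where
  "L r x = {last (r y) | y. y < x \<and> r y \<noteq> []}"

definition \<chi> :: "nat set \<Rightarrow> (nat \<Rightarrow> nat list) \<Rightarrow> nat \<Rightarrow> nat set" where
  "\<chi> h r i = enum_app h (L r (i + 1))"

definition next_stage ::
  "p_system \<Rightarrow> nat set \<Rightarrow> nat \<times> (nat \<Rightarrow> nat list) \<Rightarrow> nat \<times> (nat \<Rightarrow> nat list)" where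
  "next_stage p h = (\<lambda>(m, r).
     if \<exists>k\<le>m. contra p \<in> \<chi> h r k
     then let z = (LEAST k. k \<le> m \<and> contra p \<in> \<chi> h r k) in
       (z, \<lambda>x. if x < z then r x
               else if x = z then r z @ [repl p (last (r z))]
               else [])
     else
       (m + 1, \<lambda>x. if x \<le> m then r x
                   else if x = m + 1 then [perm p (m + 1)]
                   else []))"

primrec stage :: "p_system \<Rightarrow> (nat \<Rightarrow> nat set) \<Rightarrow> nat \<Rightarrow> nat \<times> (nat \<Rightarrow> nat list)" where
  "stage p \<alpha> 0 = (0, \<lambda>x. if x = 0 then [perm p 0] else [])"
| "stage p \<alpha> (Suc s) = next_stage p (\<alpha> s) (stage p \<alpha> s)"

definition marker :: "p_system \<Rightarrow> (nat \<Rightarrow> nat set) \<Rightarrow> nat \<Rightarrow> nat" where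
  "marker p \<alpha> s = fst (stage p \<alpha> s)"

definition stack :: "p_system \<Rightarrow> (nat \<Rightarrow> nat set) \<Rightarrow> nat \<Rightarrow> nat \<Rightarrow> nat list" where
  "stack p \<alpha> s = snd (stage p \<alpha> s)"

text \<open>Since \<open>m(0) = 0\<close>, the general formula also yields \<open>A\<^sub>0 = \<emptyset>\<close>.\<close>

definition provisional_theses :: "p_system \<Rightarrow> (nat \<Rightarrow> nat set) \<Rightarrow> nat \<Rightarrow> nat set" where
  "provisional_theses p \<alpha> s = (\<Union>i<marker p \<alpha> s. \<chi> (\<alpha> s) (stack p \<alpha> s) i)"

text \<open>\<open>A\<^sub>p\<close>, computed along the approximation \<open>\<alpha>\<close>.\<close>

definition final_theses :: "p_system \<Rightarrow> (nat \<Rightarrow> nat set) \<Rightarrow> nat set" where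
  "final_theses p \<alpha> =
     {perm p x | x. \<exists>t. \<forall>s\<ge>t. perm p x \<in> provisional_theses p \<alpha> s}"

definition loopless :: "p_system \<Rightarrow> bool" where
  "loopless p \<longleftrightarrow>
     (\<exists>\<alpha>. computable_approximation \<alpha> (oper p) \<and>
       (\<forall>u. finite {last (stack p \<alpha> s u) | s. stack p \<alpha> s u \<noteq> []}))"

section \<open>Connectives and completions\<close>

text \<open>Conjunction is required to exist but is subject to no further condition.\<close>

definition connectives ::
  "p_system \<Rightarrow> (nat \<Rightarrow> nat) \<Rightarrow> (nat \<Rightarrow> nat \<Rightarrow> nat) \<Rightarrow> (nat \<Rightarrow> nat \<Rightarrow> nat) \<Rightarrow> (nat \<Rightarrow> nat \<Rightarrow> nat) \<Rightarrow> bool"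
where
  "connectives p neg imp con dis \<longleftrightarrow>
     computable neg \<and> inj neg \<and>
     computable2 imp \<and> inj (case_prod imp) \<and>
     computable2 con \<and> inj (case_prod con) \<and>
     computable2 dis \<and> inj (case_prod dis) \<and>
     (let H = enum_app (oper p); c = contra p in
       \<forall>X x y.
         c \<in> H {x, neg x} \<and>
         H {neg (neg x)} = H {x} \<and>
         dis x (neg x) \<in> H {} \<and>
         H (X \<union> {dis x y}) = H (X \<union> {x}) \<inter> H (X \<union> {y}) \<and>
         (c \<in> H (X \<union> {x}) \<longrightarrow> neg x \<in> H X) \<and>
         (x \<in> H (X \<union> {y}) \<longleftrightarrow> imp y x \<in> H X))"

definition completion :: "(nat \<Rightarrow> nat) \<Rightarrow> nat set \<Rightarrow> bool" where
  "completion neg A \<longleftrightarrow> (\<forall>x. card (A \<inter> {x, neg x}) = 1)"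

end

theory Submission
  imports Defs
begin

text \<open>
  By looplessness every stack eventually stabilises, say at \<open>R x\<close>. The top of \<open>R x\<close> is consistent
  with the tops below it, whereas each proper iterate below the top of \<open>R x\<close> has been found
  inconsistent with them; this determines \<open>R\<close>, independently of the approximation. The final theses
  are the closure \<open>T\<close> of the set of all tops, and \<open>T\<close> does not contain \<open>c\<close>, hence never both \<open>x\<close>
  and \<open>\<not> x\<close>. The bottom of \<open>R x\<close> is \<open>f\<^sub>x\<close>: either it is the top as well and lies in \<open>T\<close>, or it is
  inconsistent with the lower tops and then \<open>\<not> f\<^sub>x\<close> lies in \<open>T\<close>.
\<close>

section \<open>Monotonicity of enumeration operators and injectivity of acyclic orbits\<close>

lemma enum_app_mono: "G \<subseteq> H \<Longrightarrow> X \<subseteq> Y \<Longrightarrow> enum_app G X \<subseteq> enum_app H Y"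
  unfolding enum_app_def by blast

lemma L_cong: "(\<And>y. y < x \<Longrightarrow> r y = r' y) \<Longrightarrow> L r x = L r' x"
  unfolding L_def by (intro Collect_cong) metis

lemma L_Suc: "r x \<noteq> [] \<Longrightarrow> L r (Suc x) = insert (last (r x)) (L r x)"
  unfolding L_def by (auto simp: less_Suc_eq)

lemma L_mono: "x \<le> y \<Longrightarrow> L r x \<subseteq> L r y"
  unfolding L_def by auto

text \<open>If the iterates with indices \<open>a < b\<close> coincided, the first \<open>b\<close>
  terms would already exhaust the orbit, which would then be finite.\<close>

lemma acyclic_fun_inj_iterates:
  assumes "acyclic_fun g"
  shows "inj (\<lambda>n. (g ^^ n) x)"
proof (rule ccontr)
  assume "\<not> inj (\<lambda>n. (g ^^ n) x)"
  then obtain a b where ab: "a < b" "(g ^^ a) x = (g ^^ b) x"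
    unfolding inj_def by (metis linorder_neqE_nat)
  have "(g ^^ n) x \<in> (\<lambda>n. (g ^^ n) x) ` {..<b}" for n
  proof (induction n rule: less_induct)
    case (less n)
    show ?case
    proof (cases "n < b")
      case False
      \<comment> \<open>From index \<open>b\<close> on, every iterate repeats the one whose index is
        smaller by \<open>b - a\<close>.\<close>
      have "(g ^^ n) x = (g ^^ (n - b)) ((g ^^ b) x)"
        using False by (metis funpow_add comp_apply le_add_diff_inverse2 not_le)
      also have "\<dots> = (g ^^ (n - b + a)) x"
        by (simp add: funpow_add ab(2))
      finally show ?thesis
        using less[of "n - b + a"] ab(1) False by simp
    qed simp
  qed
  then have "range (\<lambda>n. (g ^^ n) x) \<subseteq> (\<lambda>n. (g ^^ n) x) ` {..<b}" by blast
  then have "finite (range (\<lambda>n. (g ^^ n) x))"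
    using finite_surj by blast
  with assms show False unfolding acyclic_fun_def by blast
qed

section \<open>Run-independent description of the limit stacks\<close>

definition attempt :: "p_system \<Rightarrow> nat \<Rightarrow> nat \<Rightarrow> nat" where
  "attempt p x k = (repl p ^^ k) (perm p x)"

text \<open>Inconsistency is judged by \<open>oper p\<close> and not by a finite stage of it, which
  makes stacks of different runs comparable. The bound \<open>Suc k < length (r x)\<close> leaves
  out the top, which during a run may or may not be consistent.\<close>

definition well_stacked :: "p_system \<Rightarrow> (nat \<Rightarrow> nat list) \<Rightarrow> nat \<Rightarrow> bool" where
  "well_stacked p r x \<longleftrightarrow>
     r x = map (attempt p x) [0..<length (r x)] \<and>
     (\<forall>k. Suc k < length (r x) \<longrightarrow>
        contra p \<in> enum_app (oper p) (insert (attempt p x k) (L r x)))"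

text \<open>Collects what limit stacks below \<open>u\<close> satisfy without mentioning a run; this
  carries information from one approximation to another.\<close>

definition admissible :: "p_system \<Rightarrow> (nat \<Rightarrow> nat list) \<Rightarrow> nat \<Rightarrow> bool" where
  "admissible p r u \<longleftrightarrow>
     (\<forall>x<u. r x \<noteq> [] \<and> well_stacked p r x \<and> contra p \<notin> enum_app (oper p) (L r (Suc x)))"

lemma well_stacked_cong:
  assumes "\<And>y. y \<le> x \<Longrightarrow> r y = r' y"
  shows "well_stacked p r x = well_stacked p r' x"
  using assms L_cong[of x r r'] unfolding well_stacked_def by simp

lemma last_well_stacked:
  assumes "well_stacked p r x" "r x \<noteq> []"
  shows "last (r x) = attempt p x (length (r x) - 1)"
proof -
  have "last (r x) = r x ! (length (r x) - 1)"
    using assms(2) by (rule last_conv_nth)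
  also have "\<dots> = map (attempt p x) [0..<length (r x)] ! (length (r x) - 1)"
    using assms(1) unfolding well_stacked_def by metis
  finally show ?thesis using assms(2) by simp
qed

text \<open>Otherwise the top of \<open>r' x\<close> would be a non-top entry of \<open>r x\<close>,
  hence inconsistent with the common lower tops. Here \<open>r\<close> may be a configuration still
  in motion.\<close>

lemma well_stacked_length_le:
  assumes "well_stacked p r x" "well_stacked p r' x" "r' x \<noteq> []"
    and "\<And>y. y < x \<Longrightarrow> r y = r' y"
    and "contra p \<notin> enum_app (oper p) (L r' (Suc x))"
  shows "length (r x) \<le> length (r' x)"
proof (rule ccontr)
  assume *: "\<not> ?thesis"
  have "Suc (length (r' x) - 1) < length (r x)"
    using * assms(3) by (cases "r' x") auto
  with assms(1) have "contra p \<in> enum_app (oper p) (insert (last (r' x)) (L r x))"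
    unfolding well_stacked_def last_well_stacked[OF assms(2,3)] by blast
  with assms(3,5) L_cong[OF assms(4)] show False by (simp add: L_Suc)
qed

text \<open>Once all lower stacks agree, the two lengths bound each other, and the length determines
  the stack.\<close>

lemma admissible_unique:
  assumes "admissible p r u" "admissible p r' u" "x < u"
  shows "r x = r' x"
  using assms(3)
proof (induction x rule: less_induct)
  case (less x)
  have r: "r x \<noteq> []" "well_stacked p r x" "contra p \<notin> enum_app (oper p) (L r (Suc x))"
    and r': "r' x \<noteq> []" "well_stacked p r' x" "contra p \<notin> enum_app (oper p) (L r' (Suc x))"
    using assms(1,2) less.prems unfolding admissible_def by blast+
  have below: "r y = r' y" if "y < x" for y
    using less that by simp
  have "length (r x) = length (r' x)"
    using well_stacked_length_le[OF r(2) r'(2) r'(1) below r'(3)]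
      well_stacked_length_le[OF r'(2) r(2) r(1) below[symmetric] r(3)] by simp
  with r(2) r'(2) show ?case unfolding well_stacked_def by metis
qed

section \<open>Single stages of a run and the stack invariant\<close>

locale dialectical_run =
  fixes p :: p_system and \<alpha> :: "nat \<Rightarrow> nat set"
  assumes approximation: "computable_approximation \<alpha> (oper p)"
begin

abbreviation "m \<equiv> marker p \<alpha>"
abbreviation "stk \<equiv> stack p \<alpha>"

text \<open>The position at which the procedure replaces a top at stage \<open>s\<close>; when there
  is none, the marker advances instead.\<close>

definition active :: "nat \<Rightarrow> nat \<Rightarrow> bool" where
  "active s z \<longleftrightarrow> z \<le> m s \<and> contra p \<in> \<chi> (\<alpha> s) (stk s) z \<and>
     (\<forall>k<z. contra p \<notin> \<chi> (\<alpha> s) (stk s) k)"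

lemma ex_active:
  assumes "k \<le> m s" "contra p \<in> \<chi> (\<alpha> s) (stk s) k"
  shows "\<exists>z. active s z"
proof -
  let ?P = "\<lambda>k. contra p \<in> \<chi> (\<alpha> s) (stk s) k"
  have "active s (Least ?P)"
    unfolding active_def
  proof (intro conjI allI impI)
    show "Least ?P \<le> m s"
      using Least_le[of ?P, OF assms(2)] assms(1) by (rule le_trans)
    show "?P (Least ?P)"
      by (rule LeastI[of ?P, OF assms(2)])
    show "\<not> ?P k" if "k < Least ?P" for k
      using that by (rule not_less_Least)
  qed
  then show ?thesis ..
qed

lemma approx_subset: "\<alpha> s \<subseteq> oper p"
  using approximation unfolding computable_approximation_def by blast

lemma approx_mono: "s \<le> t \<Longrightarrow> \<alpha> s \<subseteq> \<alpha> t"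
  using approximation lift_Suc_mono_le[of \<alpha>] unfolding computable_approximation_def by blast

lemma enum_app_approx:
  assumes "x \<in> enum_app (oper p) X"
  obtains t where "\<And>s. t \<le> s \<Longrightarrow> x \<in> enum_app (\<alpha> s) X"
proof -
  obtain D where D: "finite D" "D \<subseteq> X" "prod_encode (x, set_encode D) \<in> oper p"
    using assms unfolding enum_app_def by blast
  then obtain t where "prod_encode (x, set_encode D) \<in> \<alpha> t"
    using approximation unfolding computable_approximation_def by blast
  with D(1,2) that[of t] approx_mono show ?thesis unfolding enum_app_def by blast
qed

lemma stage_0: "m 0 = 0" "stk 0 x = (if x = 0 then [perm p 0] else [])"
  by (simp_all add: marker_def stack_def)

lemma stage_inactive:
  assumes "\<nexists>z. active s z"
  shows "m (Suc s) = Suc (m s)"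
    and "stk (Suc s) x = (if x \<le> m s then stk s x else if x = Suc (m s) then [perm p x] else [])"
proof -
  have "\<not> (\<exists>k\<le>m s. contra p \<in> \<chi> (\<alpha> s) (stk s) k)"
  proof
    assume "\<exists>k\<le>m s. contra p \<in> \<chi> (\<alpha> s) (stk s) k"
    with assms ex_active show False by blast
  qed
  then have "next_stage p (\<alpha> s) (m s, stk s) = (m s + 1, \<lambda>x. if x \<le> m s then stk s x
      else if x = m s + 1 then [perm p (m s + 1)] else [])"
    unfolding next_stage_def by auto
  then show "m (Suc s) = Suc (m s)"
    and "stk (Suc s) x = (if x \<le> m s then stk s x else if x = Suc (m s) then [perm p x] else [])"
    by (simp_all add: marker_def stack_def)
qed

lemma stage_active:
  assumes "active s z"
  shows "m (Suc s) = z"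
    and "stk (Suc s) x = (if x < z then stk s x
      else if x = z then stk s z @ [repl p (last (stk s z))] else [])"
proof -
  have least: "(LEAST k. k \<le> m s \<and> contra p \<in> \<chi> (\<alpha> s) (stk s) k) = z"
    using assms unfolding active_def by (intro Least_equality) (auto simp: not_less[symmetric])
  have "\<exists>k\<le>m s. contra p \<in> \<chi> (\<alpha> s) (stk s) k"
    using assms unfolding active_def by blast
  then have "next_stage p (\<alpha> s) (m s, stk s) = (z, \<lambda>x. if x < z then stk s x
      else if x = z then stk s z @ [repl p (last (stk s z))] else [])"
    unfolding next_stage_def by (simp add: least)
  then show "m (Suc s) = z"
    and "stk (Suc s) x = (if x < z then stk s x
      else if x = z then stk s z @ [repl p (last (stk s z))] else [])"
    by (simp_all add: marker_def stack_def)
qed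

lemma stk_nonempty: "x \<le> m s \<Longrightarrow> stk s x \<noteq> []"
proof (induction s arbitrary: x)
  case 0
  then show ?case by (simp add: stage_0)
next
  case (Suc s)
  show ?case
  proof (cases "\<exists>z. active s z")
    case True
    then obtain z where z: "active s z" by blast
    then have "z \<le> m s" unfolding active_def by blast
    with Suc stage_active[OF z] show ?thesis by simp
  next
    case False
    with Suc stage_inactive[OF False] show ?thesis by simp
  qed
qed

text \<open>An entry is covered only after it has been found inconsistent with the lower tops. The
  record never becomes stale, since any change of a lower stack empties the stacks above it.\<close>

lemma well_stacked_stk: "well_stacked p (stk s) x"
proof (induction s arbitrary: x)
  case 0
  then show ?case by (simp add: well_stacked_def stage_0 attempt_def)
next
  case (Suc s)
  show ?case
  proof (cases "\<exists>z. active s z")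
    case True
    then obtain z where z: "active s z" by blast
    note st = stage_active[OF z]
    consider "x < z" | "x = z" | "x > z" by linarith
    then show ?thesis
    proof cases
      case 1
      then have "well_stacked p (stk s) x = well_stacked p (stk (Suc s)) x"
        by (intro well_stacked_cong) (simp add: st)
      with Suc show ?thesis by blast
    next
      case 2
      have ne: "stk s z \<noteq> []"
        using z stk_nonempty unfolding active_def by blast
      define n where "n = length (stk s z)"
      have n: "n > 0" using ne by (simp add: n_def)
      have last: "last (stk s z) = attempt p z (n - 1)"
        unfolding n_def using last_well_stacked[OF Suc ne] .
      have "repl p (last (stk s z)) = attempt p z n"
        unfolding last using n by (cases n) (simp_all add: attempt_def)
      moreover have old: "stk s z = map (attempt p z) [0..<n]"
        using Suc[of z] unfolding well_stacked_def n_def by blast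
      ultimately have new: "stk (Suc s) z = map (attempt p z) [0..<Suc n]"
        using st by simp
      have L: "L (stk (Suc s)) z = L (stk s) z"
        using st by (intro L_cong) simp
      \<comment> \<open>The old top is the only entry newly covered. Activity shows its
        inconsistency under \<open>\<alpha> s\<close>, hence under \<open>oper p\<close>.\<close>
      have "contra p \<in> enum_app (oper p) (insert (attempt p z (n - 1)) (L (stk s) z))"
        using z enum_app_mono[OF approx_subset subset_refl, of s] L_Suc[of "stk s" z] ne
        unfolding active_def \<chi>_def last by auto
      moreover have "contra p \<in> enum_app (oper p) (insert (attempt p z k) (L (stk s) z))"
        if "Suc k < n" for k
        using Suc[of z] that unfolding well_stacked_def n_def by blast
      ultimately have "contra p \<in> enum_app (oper p) (insert (attempt p z k) (L (stk s) z))"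
        if "k < n" for k
        using that by (cases "k = n - 1") auto
      with new L 2 show ?thesis unfolding well_stacked_def by simp
    next
      case 3
      then show ?thesis using st by (simp add: well_stacked_def)
    qed
  next
    case False
    note st = stage_inactive[OF False]
    show ?thesis
    proof (cases "x \<le> m s")
      case True
      then have "well_stacked p (stk s) x = well_stacked p (stk (Suc s)) x"
        by (intro well_stacked_cong) (simp add: st)
      with Suc show ?thesis by blast
    next
      case False
      then show ?thesis using st by (simp add: well_stacked_def attempt_def)
    qed
  qed
qed

section \<open>Stabilisation of initial segments of stacks\<close>

text \<open>The marker may return to \<open>u\<close> itself, so the stack at \<open>u\<close> may
  still change; the bound on the marker keeps the stacks below \<open>u\<close> nonempty.\<close>

definition settled :: "nat \<Rightarrow> nat \<Rightarrow> bool" where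
  "settled u t \<longleftrightarrow> (\<forall>s\<ge>t. u \<le> m s \<and> (\<forall>x<u. stk s x = stk t x))"

lemma settled_marker: "settled u t \<Longrightarrow> t \<le> s \<Longrightarrow> u \<le> m s"
  unfolding settled_def by blast

lemma settled_stk: "settled u t \<Longrightarrow> t \<le> s \<Longrightarrow> x < u \<Longrightarrow> stk s x = stk t x"
  unfolding settled_def by blast

lemma settled_mono:
  assumes "settled u t" "v \<le> u" "t \<le> s"
  shows "settled v s"
  unfolding settled_def
proof (intro allI impI conjI)
  fix s' assume s': "s \<le> s'"
  then have ts': "t \<le> s'" using assms(3) by simp
  show "v \<le> m s'" using settled_marker[OF assms(1) ts'] assms(2) by simp
  fix x assume "x < v"
  then have "x < u" using assms(2) by simp
  then show "stk s' x = stk s x"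
    using settled_stk[OF assms(1) ts'] settled_stk[OF assms(1,3)] by simp
qed

text \<open>A nonempty stack below the marker changes only when the marker drops to its position or
  lower.\<close>

lemma settledI:
  assumes "\<And>s. t \<le> s \<Longrightarrow> u \<le> m s"
  shows "settled u t"
proof -
  have "stk s x = stk t x" if "t \<le> s" "x < u" for s x
    using that(1)
  proof (induction s rule: dec_induct)
    case (step s)
    have "x < m s" "x < m (Suc s)"
      using assms[of s] assms[of "Suc s"] step(1) that(2) by auto
    then have "stk (Suc s) x = stk s x"
      using stage_active stage_inactive by (cases "\<exists>z. active s z") auto
    with step show ?case by simp
  qed simp
  with assms show ?thesis unfolding settled_def by blast
qed

text \<open>An inconsistency among settled tops would eventually be enumerated by the approximation;
  the procedure would then act at some \<open>z \<le> x\<close> and put the marker on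
  \<open>z\<close>.\<close>

lemma settled_not_contra:
  assumes "settled (Suc x) t"
  shows "contra p \<notin> enum_app (oper p) (L (stk t) (Suc x))"
proof
  assume "contra p \<in> enum_app (oper p) (L (stk t) (Suc x))"
  then obtain t' where t': "\<And>s. t' \<le> s \<Longrightarrow> contra p \<in> enum_app (\<alpha> s) (L (stk t) (Suc x))"
    using enum_app_approx by blast
  define s where "s = max t t'"
  have s: "t \<le> s" "t' \<le> s" by (auto simp: s_def)
  have m: "Suc x \<le> m s" "Suc x \<le> m (Suc s)" and stk: "\<And>y. y < Suc x \<Longrightarrow> stk s y = stk t y"
    using settled_marker[OF assms, of s] settled_marker[OF assms, of "Suc s"]
      settled_stk[OF assms, of s] s(1) by simp_all
  have c: "contra p \<in> \<chi> (\<alpha> s) (stk s) x"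
    unfolding \<chi>_def using t'[OF s(2)] L_cong[OF stk] by simp
  obtain z where z: "active s z" using ex_active[OF _ c] m(1) by auto
  then have "z \<le> x" using c unfolding active_def by (metis not_le)
  with stage_active(1)[OF z] m(2) show False by simp
qed

lemma settled_admissible:
  assumes "settled u t"
  shows "admissible p (stk t) u"
proof -
  have "stk t x \<noteq> []" if "x < u" for x
    using settled_marker[OF assms order_refl] that stk_nonempty[of x t] by simp
  then show ?thesis
    using well_stacked_stk settled_not_contra settled_mono[OF assms _ order_refl]
    unfolding admissible_def by (auto simp: Suc_le_eq)
qed

text \<open>With everything below \<open>u\<close> frozen, the stack at \<open>u\<close> can no
  longer be emptied once created, only extended. Bounded length then leaves room for finitely many
  replacements.\<close>

lemma settled_Suc:
  assumes "settled u t" and bound: "\<And>s. t \<le> s \<Longrightarrow> length (stk s u) \<le> B"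
  shows "\<exists>t'. settled (Suc u) t'"
proof -
  define N where "N = Max ((\<lambda>s. length (stk s u)) ` {t..})"
  have fin: "finite ((\<lambda>s. length (stk s u)) ` {t..})"
    by (rule finite_subset[of _ "{..B}"]) (use bound in auto)
  have "N \<in> (\<lambda>s. length (stk s u)) ` {t..}"
    unfolding N_def by (rule Max_in[OF fin]) auto
  then obtain t1 where t1: "t \<le> t1" "length (stk t1 u) = N" by auto
  have max: "length (stk s u) \<le> N" if "t \<le> s" for s
    unfolding N_def using that by (intro Max_ge[OF fin]) auto
  \<comment> \<open>Where the maximal length is attained, a replacement at \<open>u\<close> would
    exceed it, so any activity happens strictly above \<open>u\<close>.\<close>
  have stable: "u < m (Suc s) \<and> stk (Suc s) u = stk s u"
    if s: "t \<le> s" "length (stk s u) = N" for s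
  proof (cases "\<exists>z. active s z")
    case True
    then obtain z where z: "active s z" by blast
    note st = stage_active[OF z]
    have "u \<le> z" using settled_marker[OF assms(1), of "Suc s"] s(1) st(1) by simp
    moreover have "z \<noteq> u" using max[of "Suc s"] s st(2) by auto
    ultimately show ?thesis using st by simp
  next
    case False
    have "u \<le> m s" using assms(1) s(1) unfolding settled_def by blast
    with stage_inactive[OF False] show ?thesis by simp
  qed
  have len: "length (stk s u) = N" if "t1 \<le> s" for s
    using that
  proof (induction s rule: dec_induct)
    case base
    show ?case by (rule t1(2))
  next
    case (step s)
    then show ?case using stable[of s] t1(1) by simp
  qed
  \<comment> \<open>At stage \<open>t1\<close> the marker may still stand on \<open>u\<close>; it
    exceeds \<open>u\<close> from the next stage on.\<close>
  have "settled (Suc u) (Suc t1)"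
  proof (rule settledI)
    fix s assume "Suc t1 \<le> s"
    then obtain s' where "s = Suc s'" "t1 \<le> s'" by (cases s) auto
    with stable[of s'] len[of s'] t1(1) show "Suc u \<le> m s" by simp
  qed
  then show ?thesis ..
qed

text \<open>Isolates the length bound as a premise, because it has two sources: finiteness of the
  set of tops, or comparison with admissible stacks.\<close>

lemma ex_settled:
  assumes "\<And>u t. settled u t \<Longrightarrow> \<exists>B. \<forall>s\<ge>t. length (stk s u) \<le> B"
  shows "\<exists>t. settled u t"
proof (induction u)
  case 0
  then show ?case by (auto simp: settled_def)
next
  case (Suc u)
  then obtain t where t: "settled u t" ..
  then obtain B where "\<forall>s\<ge>t. length (stk s u) \<le> B" using assms by blast
  then show ?case using settled_Suc[OF t] by blast
qed

text \<open>By acyclicity different lengths give different tops, so finitely many tops allow only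
  finitely many lengths.\<close>

lemma loopless_ex_settled:
  assumes "acyclic_fun (repl p)"
    and "\<And>u. finite {last (stk s u) | s. stk s u \<noteq> []}"
  shows "\<exists>t. settled u t"
proof (rule ex_settled)
  fix u t
  have "attempt p u ` ((\<lambda>s. length (stk s u) - 1) ` {s. stk s u \<noteq> []})
      = (\<lambda>s. last (stk s u)) ` {s. stk s u \<noteq> []}"
    unfolding image_image using last_well_stacked[OF well_stacked_stk]
    by (intro image_cong refl) simp
  also have "\<dots> = {last (stk s u) | s. stk s u \<noteq> []}" by blast
  finally have "finite (attempt p u ` ((\<lambda>s. length (stk s u) - 1) ` {s. stk s u \<noteq> []}))"
    using assms(2) by simp
  moreover have "inj (attempt p u)"
    unfolding attempt_def[abs_def] by (rule acyclic_fun_inj_iterates[OF assms(1)])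
  ultimately have "finite ((\<lambda>s. length (stk s u) - 1) ` {s. stk s u \<noteq> []})"
    using finite_imageD inj_on_subset by blast
  then obtain B where B: "\<And>s. stk s u \<noteq> [] \<Longrightarrow> length (stk s u) - 1 \<le> B"
    using finite_nat_set_iff_bounded_le by auto
  have "length (stk s u) \<le> Suc B" for s
    using B[of s] by (cases "stk s u = []") auto
  then show "\<exists>B. \<forall>s\<ge>t. length (stk s u) \<le> B" by blast
qed

text \<open>The admissible stacks may come from a different approximation. The settled lower stacks
  agree with them by uniqueness, so the stack at \<open>u\<close> cannot outgrow \<open>R u\<close>,
  whose top is consistent and is never discarded.\<close>

lemma admissible_ex_settled:
  assumes R: "\<And>u. \<exists>R. admissible p R u"
  shows "\<exists>t. settled u t"
proof (rule ex_settled)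
  fix u t assume t: "settled u t"
  obtain R where R: "admissible p R (Suc u)" using R by blast
  have "length (stk s u) \<le> length (R u)" if s: "t \<le> s" for s
  proof (rule well_stacked_length_le[OF well_stacked_stk])
    show "well_stacked p R u" "R u \<noteq> []" "contra p \<notin> enum_app (oper p) (L R (Suc u))"
      using R unfolding admissible_def by auto
    have "admissible p R u" using R unfolding admissible_def by simp
    then show "stk s y = R y" if "y < u" for y
      using admissible_unique[OF settled_admissible[OF settled_mono[OF t order_refl s]]] that
      by blast
  qed
  then show "\<exists>B. \<forall>s\<ge>t. length (stk s u) \<le> B" by blast
qed

section \<open>The final theses as the closure of the limit tops\<close>

text \<open>
  The index \<open>i\<close> witnessing membership in \<open>provisional_theses p \<alpha> s\<close> may vary with \<open>s\<close>. At a
  stage \<open>s\<close> that minimises \<open>m\<close> over all later stages, however, all stacks below \<open>m s\<close> are final.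
\<close>

lemma final_thesesD:
  assumes "x \<in> final_theses p \<alpha>"
  shows "\<exists>u t. settled u t \<and> x \<in> enum_app (oper p) (L (stk t) u)"
proof -
  obtain t where t: "\<And>s. t \<le> s \<Longrightarrow> x \<in> provisional_theses p \<alpha> s"
    using assms unfolding final_theses_def by blast
  define s where "s = arg_min m (\<lambda>s. t \<le> s)"
  have s: "t \<le> s" unfolding s_def by (rule arg_min_natI[of _ t]) simp
  have "m s \<le> m s'" if "s \<le> s'" for s'
    unfolding s_def by (rule arg_min_nat_le) (use s that in \<open>simp add: s_def\<close>)
  then have "settled (m s) s" by (rule settledI)
  moreover obtain i where "i < m s" "x \<in> enum_app (\<alpha> s) (L (stk s) (Suc i))"
    using t[OF s] unfolding provisional_theses_def \<chi>_def by auto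
  then have "x \<in> enum_app (oper p) (L (stk s) (m s))"
    using enum_app_mono[OF approx_subset L_mono[of "Suc i" "m s"]] by (auto simp: Suc_le_eq)
  ultimately show ?thesis by blast
qed

text \<open>After the approximation has enumerated \<open>x\<close> from the settled tops, the fixed
  index \<open>u\<close> witnesses membership at every later stage.\<close>

lemma final_thesesI:
  assumes "surj (perm p)" "settled (Suc u) t" "x \<in> enum_app (oper p) (L (stk t) (Suc u))"
  shows "x \<in> final_theses p \<alpha>"
proof -
  obtain t' where t': "\<And>s. t' \<le> s \<Longrightarrow> x \<in> enum_app (\<alpha> s) (L (stk t) (Suc u))"
    using assms(3) enum_app_approx by blast
  have "x \<in> provisional_theses p \<alpha> s" if s: "max t t' \<le> s" for s
  proof -
    have m: "u < m s" and stk: "\<And>y. y < Suc u \<Longrightarrow> stk s y = stk t y"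
      using settled_marker[OF assms(2), of s] settled_stk[OF assms(2), of s] s by simp_all
    have "x \<in> \<chi> (\<alpha> s) (stk s) u"
      unfolding \<chi>_def using t'[of s] s L_cong[OF stk] by simp
    with m show ?thesis unfolding provisional_theses_def by blast
  qed
  moreover obtain y where "x = perm p y" using assms(1) by blast
  ultimately show ?thesis unfolding final_theses_def by blast
qed

text \<open>Finitely many final theses follow from the tops below one common level. If they were
  inconsistent, idempotence of the closure would make these tops inconsistent as well.\<close>

lemma final_theses_consistent:
  assumes closure: "algebraic_closure_operator (oper p)"
    and settled: "\<And>u. \<exists>t. settled u t"
    and X: "finite X" "X \<subseteq> final_theses p \<alpha>"
  shows "contra p \<notin> enum_app (oper p) X"
proof
  assume c: "contra p \<in> enum_app (oper p) X"
  have "\<exists>u. \<forall>t. settled u t \<longrightarrow> X \<subseteq> enum_app (oper p) (L (stk t) u)"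
    using X
  proof (induction X rule: finite_induct)
    case (insert x X)
    then obtain v where v: "\<And>t. settled v t \<Longrightarrow> X \<subseteq> enum_app (oper p) (L (stk t) v)" by blast
    obtain w t where w: "settled w t" "x \<in> enum_app (oper p) (L (stk t) w)"
      using final_thesesD insert.prems by blast
    have "insert x X \<subseteq> enum_app (oper p) (L (stk t') (max v w))"
      if t': "settled (max v w) t'" for t'
    proof -
      have sv: "settled v t'" and sw: "settled w t'"
        using settled_mono[OF t'] by simp_all
      \<comment> \<open>The stages \<open>t\<close> and \<open>t'\<close> need not be comparable in
        a known order; uniqueness of admissible stacks identifies the tops.\<close>
      have L: "L (stk t) w = L (stk t') w"
        using admissible_unique[OF settled_admissible[OF w(1)] settled_admissible[OF sw]]
        by (rule L_cong)
      have "enum_app (oper p) (L (stk t') i) \<subseteq> enum_app (oper p) (L (stk t') (max v w))"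
        if "i \<le> max v w" for i
        using that by (intro enum_app_mono L_mono subset_refl)
      from this[of v] this[of w] v[OF sv]
      have "X \<subseteq> enum_app (oper p) (L (stk t') (max v w))"
        and "enum_app (oper p) (L (stk t') w) \<subseteq> enum_app (oper p) (L (stk t') (max v w))"
        by simp_all
      with w(2) L show ?thesis by auto
    qed
    then show ?case by blast
  qed simp
  then obtain u where u: "\<And>t. settled u t \<Longrightarrow> X \<subseteq> enum_app (oper p) (L (stk t) u)" by blast
  \<comment> \<open>The level is raised to a successor, the form in which consistency of settled
    tops is available.\<close>
  obtain t where t: "settled (Suc u) t" using settled by blast
  have "X \<subseteq> enum_app (oper p) (L (stk t) (Suc u))"
    using u[of t] settled_mono[OF t] enum_app_mono[OF subset_refl L_mono[of u "Suc u"]] by fastforce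
  then have "contra p \<in> enum_app (oper p) (enum_app (oper p) (L (stk t) (Suc u)))"
    using c enum_app_mono[OF subset_refl] by blast
  then have "contra p \<in> enum_app (oper p) (L (stk t) (Suc u))"
    using closure unfolding algebraic_closure_operator_def by blast
  with settled_not_contra[OF t] show False by blast
qed

lemma final_theses_complete:
  assumes closure: "algebraic_closure_operator (oper p)"
    and settled: "\<And>u. \<exists>t. settled u t"
    and "surj (perm p)"
    and neg: "\<And>X x. contra p \<in> enum_app (oper p) (insert x X) \<Longrightarrow> neg x \<in> enum_app (oper p) X"
  shows "x \<in> final_theses p \<alpha> \<or> neg x \<in> final_theses p \<alpha>"
proof -
  obtain u where u: "x = perm p u" using assms(3) by blast
  obtain t where t: "settled (Suc u) t" using settled by blast
  have ne: "stk t u \<noteq> []" and ws: "well_stacked p (stk t) u"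
    using settled_admissible[OF t] unfolding admissible_def by auto
  have "x \<in> enum_app (oper p) (L (stk t) (Suc u)) \<or> neg x \<in> enum_app (oper p) (L (stk t) (Suc u))"
  proof (cases "length (stk t u) = 1")
    case True
    then have "x \<in> L (stk t) (Suc u)"
      using last_well_stacked[OF ws ne] L_Suc[of "stk t" u, OF ne] by (simp add: u attempt_def)
    then show ?thesis using closure unfolding algebraic_closure_operator_def by blast
  next
    case False
    \<comment> \<open>The bottom entry \<open>x\<close> is therefore a covered one, and the stack
      invariant applies to it with \<open>k = 0\<close>.\<close>
    then have "Suc 0 < length (stk t u)" using ne by (cases "stk t u") auto
    then have "contra p \<in> enum_app (oper p) (insert x (L (stk t) u))"
      using ws unfolding well_stacked_def u attempt_def by force
    then have "neg x \<in> enum_app (oper p) (L (stk t) u)" by (rule neg)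
    then show ?thesis using enum_app_mono[OF subset_refl L_mono[of u "Suc u"]] by fastforce
  qed
  with final_thesesI[OF assms(3) t] show ?thesis by blast
qed

end

theorem theorem4p4:
  fixes p :: p_system
    and neg :: "nat \<Rightarrow> nat"
    and imp con dis :: "nat \<Rightarrow> nat \<Rightarrow> nat"
    and \<alpha> :: "nat \<Rightarrow> nat set"
  assumes "p_dialectical_system p"
    and "loopless p"
    and "connectives p neg imp con dis"
    and "computable_approximation \<alpha> (oper p)"
  shows "completion neg (final_theses p \<alpha>)"
proof -
  interpret dialectical_run p \<alpha>
    by (rule dialectical_run.intro) (rule assms(4))
  have closure: "algebraic_closure_operator (oper p)" and surj: "surj (perm p)"
    and acyclic: "acyclic_fun (repl p)"
    using assms(1) unfolding p_dialectical_system_def by (auto dest: bij_is_surj)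
  have c: "contra p \<in> enum_app (oper p) {x, neg x}" for x
    using assms(3) unfolding connectives_def Let_def by blast
  have "contra p \<in> enum_app (oper p) (X \<union> {x}) \<longrightarrow> neg x \<in> enum_app (oper p) X" for X x
    using assms(3) unfolding connectives_def Let_def by blast
  then have neg: "contra p \<in> enum_app (oper p) (insert x X) \<Longrightarrow> neg x \<in> enum_app (oper p) X" for X x
    by simp
  obtain \<beta> where \<beta>: "computable_approximation \<beta> (oper p)"
    "\<And>u. finite {last (stack p \<beta> s u) | s. stack p \<beta> s u \<noteq> []}"
    using assms(2) unfolding loopless_def by blast
  interpret \<beta>: dialectical_run p \<beta>
    by (rule dialectical_run.intro) (rule \<beta>(1))
  \<comment> \<open>Looplessness bounds the tops along \<open>\<beta>\<close> only; the admissible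
    stacks found there force stabilisation along \<open>\<alpha>\<close>.\<close>
  have settled: "\<exists>t. settled u t" for u
    using admissible_ex_settled \<beta>.settled_admissible \<beta>.loopless_ex_settled[OF acyclic \<beta>(2)] by metis
  show ?thesis
    unfolding completion_def
  proof
    fix x
    have "\<not> {x, neg x} \<subseteq> final_theses p \<alpha>"
      using final_theses_consistent[OF closure settled, of "{x, neg x}"] c[of x] by blast
    moreover have "x \<in> final_theses p \<alpha> \<or> neg x \<in> final_theses p \<alpha>"
      by (rule final_theses_complete[OF closure settled surj neg])
    ultimately have "final_theses p \<alpha> \<inter> {x, neg x} = {x} \<or>
        final_theses p \<alpha> \<inter> {x, neg x} = {neg x}" by blast
    then show "card (final_theses p \<alpha> \<inter> {x, neg x}) = 1" by auto
  qed
qed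

end
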